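(* Let $p,q\geq 2$ and let $X$ be a based space. For all $f\in \Omega^p(X)$ and $g\in \Omega^q(X)$, we have $[ f,g]\simeq_{ir} (-1)^{pq}[ g,f]$.
   Context: All spaces are Hausdorff and maps are continuous and based. $\Omega^m(X)=\Omega^m(X,x_0)$ is the set of maps $(I^m,\partial I^m)\to (X,x_0)$, $I=[0,1]$, identified with based maps $S^m\to X$ via a fixed homeomorphism $I^m/\partial I^m\cong S^m$; $-f(t_1,\dots,t_m)=f(1-t_1,t_2,\dots,t_m)$, and $(-1)^e f$ means $f$ or $-f$ according to the parity of $e$. $a_{p,q}:S^{p+q-1}\to S^p\vee S^q$ is the standard (surjective) attaching map of the $(p+q)$-cell of $S^p\times S^q$, i.e. the restriction of the product characteristic map $D^p\times D^q\to S^p\times S^q$ to the boundary, with the usual orientation conventions, for which the classical relation $[a,b]=(-1)^{pq}[b,a]$ holds on homotopy classes $a\in\pi_p$, $b\in\pi_q$ (this may be taken as known). For $f\in\Omega^p(X)$, $g\in\Omega^q(X)$, $[f,g]=(f\vee g)\circ a_{p,q}\in\Omega^{p+q-1}(X)$. Based maps $f,g:Y\to X$ are image-relative homotopic, written $f\simeq_{ir}g$, if there is a based homotopy $H:Y\times I\to X$ from $f$ to $g$ with $\operatorname{Im}(H)=\operatorname{Im}(f)\cup\operatorname{Im}(g)$. *)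

theory Defs
  imports "HOL-Analysis.Analysis"
begin

text \<open>
  Points of \<open>R\<^sup>m\<close> are functions \<open>nat \<Rightarrow> real\<close> vanishing from index \<open>m\<close> on, as in
  \<^const>\<open>Euclidean_space\<close>; coordinates are numbered from \<open>0\<close>. The sphere \<open>S\<^sup>m\<close> is
  \<^term>\<open>nsphere m\<close>, the unit sphere in \<open>R\<^sup>m\<^sup>+\<^sup>1\<close>.
\<close>

section \<open>Cubes and the space \<open>\<Omega>\<^sup>m(X)\<close>\<close>

definition cube :: "nat \<Rightarrow> (nat \<Rightarrow> real) topology" where
  "cube m = subtopology (Euclidean_space m) {t. \<forall>i<m. t i \<in> {0..1}}"

definition cube_boundary :: "nat \<Rightarrow> (nat \<Rightarrow> real) set" where
  "cube_boundary m = {t \<in> topspace (cube m). \<exists>i<m. t i = 0 \<or> t i = 1}"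

text \<open>Only the values of a function on the cube matter; no convention is imposed elsewhere.\<close>

definition Omega :: "nat \<Rightarrow> 'a topology \<Rightarrow> 'a \<Rightarrow> ((nat \<Rightarrow> real) \<Rightarrow> 'a) set" where
  "Omega m X x0 = {f. continuous_map (cube m) X f \<and> (\<forall>t \<in> cube_boundary m. f t = x0)}"

definition neg_loop :: "((nat \<Rightarrow> real) \<Rightarrow> 'a) \<Rightarrow> (nat \<Rightarrow> real) \<Rightarrow> 'a" where
  "neg_loop f = (\<lambda>t. f (t(0 := 1 - t 0)))"

definition sign_loop :: "nat \<Rightarrow> ((nat \<Rightarrow> real) \<Rightarrow> 'a) \<Rightarrow> (nat \<Rightarrow> real) \<Rightarrow> 'a" where
  "sign_loop e f = (if even e then f else neg_loop f)"

section \<open>The identification of \<open>I\<^sup>m/\<partial>I\<^sup>m\<close> with \<open>S\<^sup>m\<close>\<close>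

definition sup_norm :: "nat \<Rightarrow> (nat \<Rightarrow> real) \<Rightarrow> real" where
  "sup_norm m x = Max ((\<lambda>i. \<bar>x i\<bar>) ` {..<m})"

definition sphere_base :: "nat \<Rightarrow> real" where
  "sphere_base = (\<lambda>i. if i = 0 then - 1 else 0)"

text \<open>
  With \<open>x = 2t - 1 \<in> [-1,1]\<^sup>m\<close> and \<open>v = x / (1 - |x|\<^sub>\<infinity>)\<close>, which maps the open cube
  homeomorphically onto \<open>R\<^sup>m\<close>, this is the inverse stereographic projection
  \<open>(1 - |v|\<^sup>2, 2v) / (1 + |v|\<^sup>2)\<close> from the base point \<open>(-1,0,\<dots>,0)\<close>. Clearing the denominator
  \<open>1 - |x|\<^sub>\<infinity>\<close> gives a formula on the closed cube that sends precisely the boundary to the base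
  point. The centre of the cube goes to \<open>(1,0,\<dots>,0)\<close>, where the derivative is a positive multiple
  of \<open>w \<mapsto> (0,w)\<close>, so the map has degree one when the sphere is oriented as the
  boundary of the ball (outward normal first).
\<close>

definition collapse :: "nat \<Rightarrow> (nat \<Rightarrow> real) \<Rightarrow> nat \<Rightarrow> real" where
  "collapse m t =
    (let x = (\<lambda>i. 2 * t i - 1);
         u = 1 - sup_norm m x;
         s = (\<Sum>i<m. (x i)\<^sup>2)
     in (\<lambda>i. if i = 0 then (u\<^sup>2 - s) / (u\<^sup>2 + s)
             else if i \<le> m then 2 * u * x (i - 1) / (u\<^sup>2 + s)
             else 0))"

text \<open>
  The based map \<open>S\<^sup>m \<rightarrow> X\<close> corresponding to \<open>f \<in> \<Omega>\<^sup>m(X)\<close>. The choice of preimage is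
  immaterial, because \<open>f\<close> is constant on the boundary of the cube and \<open>collapse m\<close> identifies
  no other points.
\<close>

definition sphere_map :: "nat \<Rightarrow> ((nat \<Rightarrow> real) \<Rightarrow> 'a) \<Rightarrow> (nat \<Rightarrow> real) \<Rightarrow> 'a" where
  "sphere_map m f = f \<circ> inv_into (topspace (cube m)) (collapse m)"

section \<open>The attaching map and the product \<open>[f,g]\<close>\<close>

definition sphere_wedge :: "nat \<Rightarrow> nat \<Rightarrow> ((nat \<Rightarrow> real) \<times> (nat \<Rightarrow> real)) topology" where
  "sphere_wedge p q = subtopology (prod_topology (nsphere p) (nsphere q))
     {(x, y). x = sphere_base \<or> y = sphere_base}"

definition wedge_map :: "((nat \<Rightarrow> real) \<Rightarrow> 'a) \<Rightarrow> ((nat \<Rightarrow> real) \<Rightarrow> 'a)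
    \<Rightarrow> (nat \<Rightarrow> real) \<times> (nat \<Rightarrow> real) \<Rightarrow> 'a" where
  "wedge_map f g = (\<lambda>(x, y). if y = sphere_base then f x else g y)"

text \<open>
  The rotation of \<open>R\<^sup>n\<close> in the plane spanned by \<open>e = (1,0,\<dots>,0)\<close> and \<open>d = (1,\<dots>,1) / \<surd>n\<close> that
  takes \<open>e\<close> to \<open>d\<close>, i.e.
  \<open>x \<mapsto> x - (e + d)\<bullet>x / (1 + e\<bullet>d) * (e + d) + 2 (e\<bullet>x) d\<close>.
\<close>

definition diag_rotation :: "nat \<Rightarrow> (nat \<Rightarrow> real) \<Rightarrow> nat \<Rightarrow> real" where
  "diag_rotation n x =
    (let d = (\<lambda>i. 1 / sqrt (real n));
         e = (\<lambda>i. if i = 0 then 1 else 0);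
         c = (\<Sum>i<n. (e i + d i) * x i) / (1 + 1 / sqrt (real n))
     in (\<lambda>i. if i < n then x i - c * (e i + d i) + 2 * x 0 * d i else 0))"

text \<open>
  The homeomorphism of \<open>S\<^sup>n\<^sup>-\<^sup>1\<close> with the boundary of \<open>I\<^sup>n\<close> given by radial projection from the
  centre of the cube. The preceding rotation does not affect orientations; it makes
  the base point \<open>(-1,0,\<dots>,0)\<close> go to the vertex \<open>(0,\<dots>,0)\<close>, which lies in \<open>\<partial>I\<^sup>p \<times> \<partial>I\<^sup>q\<close> whenever
  \<open>p + q = n\<close> with \<open>p, q \<ge> 1\<close>.
\<close>

definition sphere_to_cube_boundary :: "nat \<Rightarrow> (nat \<Rightarrow> real) \<Rightarrow> nat \<Rightarrow> real" where
  "sphere_to_cube_boundary n z =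
    (let y = diag_rotation n z
     in (\<lambda>i. if i < n then (1 + y i / sup_norm n y) / 2 else 0))"

definition fst_coords :: "nat \<Rightarrow> (nat \<Rightarrow> real) \<Rightarrow> nat \<Rightarrow> real" where
  "fst_coords p t = (\<lambda>i. if i < p then t i else 0)"

definition snd_coords :: "nat \<Rightarrow> nat \<Rightarrow> (nat \<Rightarrow> real) \<Rightarrow> nat \<Rightarrow> real" where
  "snd_coords p q t = (\<lambda>i. if i < q then t (p + i) else 0)"

text \<open>
  The disc \<open>D\<^sup>p\<close> is modelled by \<open>I\<^sup>p\<close>, with characteristic map \<open>collapse p\<close>, so that
  \<open>D\<^sup>p \<times> D\<^sup>q\<close> is \<open>I\<^sup>p\<^sup>+\<^sup>q\<close> and its boundary is identified with \<open>S\<^sup>p\<^sup>+\<^sup>q\<^sup>-\<^sup>1\<close> as above.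
\<close>

definition attaching_map ::
  "nat \<Rightarrow> nat \<Rightarrow> (nat \<Rightarrow> real) \<Rightarrow> (nat \<Rightarrow> real) \<times> (nat \<Rightarrow> real)" where
  "attaching_map p q z =
    (let t = sphere_to_cube_boundary (p + q) z
     in (collapse p (fst_coords p t), collapse q (snd_coords p q t)))"

text \<open>
  The composite \<open>(f \<or> g) \<circ> a\<^sub>p\<^sub>,\<^sub>q : S\<^sup>p\<^sup>+\<^sup>q\<^sup>-\<^sup>1 \<rightarrow> X\<close>, regarded as an element of
  \<open>\<Omega>\<^sup>p\<^sup>+\<^sup>q\<^sup>-\<^sup>1(X)\<close> by precomposition with \<open>collapse\<close>.
\<close>

definition whitehead :: "nat \<Rightarrow> nat \<Rightarrow> ((nat \<Rightarrow> real) \<Rightarrow> 'a) \<Rightarrow> ((nat \<Rightarrow> real) \<Rightarrow> 'a)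
    \<Rightarrow> (nat \<Rightarrow> real) \<Rightarrow> 'a" where
  "whitehead p q f g =
    wedge_map (sphere_map p f) (sphere_map q g) \<circ> attaching_map p q \<circ> collapse (p + q - 1)"

section \<open>Image-relative homotopy\<close>

definition ir_homotopic ::
  "'b topology \<Rightarrow> 'b \<Rightarrow> 'a topology \<Rightarrow> 'a \<Rightarrow> ('b \<Rightarrow> 'a) \<Rightarrow> ('b \<Rightarrow> 'a) \<Rightarrow> bool" where
  "ir_homotopic Y y0 X x0 f g \<longleftrightarrow>
    (\<exists>H. continuous_map (prod_topology Y (top_of_set {0..1::real})) X H \<and>
         (\<forall>y \<in> topspace Y. H (y, 0) = f y) \<and>
         (\<forall>y \<in> topspace Y. H (y, 1) = g y) \<and>
         (\<forall>t \<in> {0..1}. H (y0, t) = x0) \<and>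
         H ` (topspace Y \<times> {0..1}) = f ` topspace Y \<union> g ` topspace Y)"

section \<open>Well-definedness of the identifications and of the attaching map\<close>

lemma topspace_cube: "topspace (cube m) = {t. (\<forall>i\<ge>m. t i = 0) \<and> (\<forall>i<m. 0 \<le> t i \<and> t i \<le> 1)}"
  by (auto simp: cube_def topspace_Euclidean_space)

lemma topspace_nsphere:
  "topspace (nsphere m) = {x. (\<forall>i>m. x i = 0) \<and> (\<Sum>i\<le>m. (x i)\<^sup>2) = 1}"
  by (auto simp: nsphere_def topspace_Euclidean_space)

lemma abs_le_sup_norm: "i < m \<Longrightarrow> \<bar>x i\<bar> \<le> sup_norm m x"
  by (simp add: sup_norm_def)

lemma sup_norm_attained:
  assumes "m \<ge> 1" obtains i where "i < m" "sup_norm m x = \<bar>x i\<bar>"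
proof -
  have "sup_norm m x \<in> (\<lambda>i. \<bar>x i\<bar>) ` {..<m}"
    unfolding sup_norm_def using assms by (intro Max_in) (auto simp: lessThan_empty_iff)
  thus ?thesis using that by auto
qed

lemma sup_norm_scale: "m \<ge> 1 \<Longrightarrow> sup_norm m (\<lambda>i. c * x i) = \<bar>c\<bar> * sup_norm m x"
proof (rule antisym)
  assume m: "m \<ge> 1"
  show "sup_norm m (\<lambda>i. c * x i) \<le> \<bar>c\<bar> * sup_norm m x"
    by (rule sup_norm_attained[OF m, of "\<lambda>i. c * x i"])
       (simp add: abs_mult abs_le_sup_norm mult_left_mono)
  show "\<bar>c\<bar> * sup_norm m x \<le> sup_norm m (\<lambda>i. c * x i)"
    by (rule sup_norm_attained[OF m, of x]) (metis abs_mult abs_le_sup_norm)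
qed

lemma sup_norm_cong: "(\<And>i. i < m \<Longrightarrow> x i = y i) \<Longrightarrow> sup_norm m x = sup_norm m y"
  by (auto simp: sup_norm_def intro!: arg_cong[where f = Max] image_cong)

lemma cube_boundary_iff_sup_norm:
  assumes "m \<ge> 1" "t \<in> topspace (cube m)"
  shows "t \<in> cube_boundary m \<longleftrightarrow> sup_norm m (\<lambda>i. 2 * t i - 1) = 1"
    and "sup_norm m (\<lambda>i. 2 * t i - 1) \<le> 1"
proof -
  have le: "\<bar>2 * t i - 1\<bar> \<le> 1" if "i < m" for i
    using assms that by (auto simp: topspace_cube abs_le_iff)
  obtain j where j: "j < m" "sup_norm m (\<lambda>i. 2 * t i - 1) = \<bar>2 * t j - 1\<bar>"
    using sup_norm_attained[OF assms(1)] by metis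
  show *: "sup_norm m (\<lambda>i. 2 * t i - 1) \<le> 1" using le j by simp
  show "t \<in> cube_boundary m \<longleftrightarrow> sup_norm m (\<lambda>i. 2 * t i - 1) = 1"
  proof
    assume "t \<in> cube_boundary m"
    then obtain i where "i < m" "\<bar>2 * t i - 1\<bar> = 1" by (auto simp: cube_boundary_def)
    thus "sup_norm m (\<lambda>i. 2 * t i - 1) = 1"
      using * abs_le_sup_norm[of i m "\<lambda>i. 2 * t i - 1"] by simp
  next
    assume "sup_norm m (\<lambda>i. 2 * t i - 1) = 1"
    with j have "t j = 0 \<or> t j = 1" by (auto simp: abs_if split: if_splits)
    thus "t \<in> cube_boundary m" using j assms by (auto simp: cube_boundary_def)
  qed
qed

lemma sum_sq_pos_boundary:
  assumes "m \<ge> 1" "sup_norm m x = (1::real)" shows "(\<Sum>i<m. (x i)\<^sup>2) > 0"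
proof -
  obtain j where j: "j < m" "sup_norm m x = \<bar>x j\<bar>" using sup_norm_attained[OF assms(1)] by metis
  hence "0 < (x j)\<^sup>2" using assms by auto
  also have "\<dots> \<le> (\<Sum>i<m. (x i)\<^sup>2)" using j by (intro member_le_sum) auto
  finally show ?thesis .
qed

lemma collapse_on_boundary:
  assumes "m \<ge> 1" "t \<in> cube_boundary m" shows "collapse m t = sphere_base"
proof -
  have N: "sup_norm m (\<lambda>i. 2 * t i - 1) = 1"
    using assms cube_boundary_iff_sup_norm by (auto simp: cube_boundary_def)
  from sum_sq_pos_boundary[OF assms(1) this] N show ?thesis
    by (auto simp: collapse_def sphere_base_def Let_def fun_eq_iff)
qed

lemma denom_pos:
  assumes "m \<ge> 1" 
  shows "(1 - sup_norm m x)\<^sup>2 + (\<Sum>i<m. (x i)\<^sup>2) > 0"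
  using sum_sq_pos_boundary[OF assms, of x] sum_nonneg[of "{..<m}" "\<lambda>i. (x i)\<^sup>2"]
  by (cases "sup_norm m x = 1") (auto intro!: add_pos_nonneg)

lemma collapse_eq_base_iff:
  assumes "m \<ge> 1" "t \<in> topspace (cube m)"
  shows "collapse m t = sphere_base \<longleftrightarrow> t \<in> cube_boundary m"
proof
  assume a: "collapse m t = sphere_base"
  define x where "x = (\<lambda>i. 2 * t i - 1)"
  define u where "u = 1 - sup_norm m x"
  define s where "s = (\<Sum>i<m. (x i)\<^sup>2)"
  have pos: "u\<^sup>2 + s > 0" using denom_pos[OF assms(1)] by (simp add: u_def s_def)
  have "collapse m t 0 = -1" using a by (simp add: sphere_base_def)
  hence "(u\<^sup>2 - s) / (u\<^sup>2 + s) = -1" by (simp add: collapse_def Let_def x_def u_def s_def)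
  with pos have "u = 0" by (simp add: field_simps)
  thus "t \<in> cube_boundary m"
    using cube_boundary_iff_sup_norm(1)[OF assms] by (simp add: u_def x_def)
qed (use collapse_on_boundary assms in auto)

lemma collapse_eq_iff:
  assumes m: "m \<ge> 1" and t: "t \<in> topspace (cube m)" and t': "t' \<in> topspace (cube m)"
  shows "collapse m t = collapse m t' \<longleftrightarrow> t = t' \<or> t \<in> cube_boundary m \<and> t' \<in> cube_boundary m"
proof
  assume eq: "collapse m t = collapse m t'"
  show "t = t' \<or> t \<in> cube_boundary m \<and> t' \<in> cube_boundary m"
  proof (cases "t \<in> cube_boundary m \<or> t' \<in> cube_boundary m")
    case True
    thus ?thesis using eq collapse_eq_base_iff[OF m] t t' by metis
  next
    case False
    define P where "P = (\<lambda>t. sup_norm m (\<lambda>i. 2 * t i - 1 :: real))"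
    have ratio: "(2 * t i - 1) / (1 - P t) = collapse m t (Suc i) / (1 + collapse m t 0)"
      and lt: "P t < 1"
      if "t \<in> topspace (cube m)" "t \<notin> cube_boundary m" "i < m" for t i
    proof -
      define x where "x = (\<lambda>i. 2 * t i - 1)"
      define u where "u = 1 - sup_norm m x"
      define s where "s = (\<Sum>i<m. (x i)\<^sup>2)"
      have pos: "u\<^sup>2 + s > 0" using denom_pos[OF m] by (simp add: u_def s_def)
      have u: "u > 0" 
        using cube_boundary_iff_sup_norm[OF m that(1)] that by (auto simp: u_def x_def)
      thus "P t < 1" by (simp add: u_def P_def x_def)
      have "collapse m t 0 = (u\<^sup>2 - s) / (u\<^sup>2 + s)" "collapse m t (Suc i) = 2 * u * x i / (u\<^sup>2 + s)"
        using that by (simp_all add: collapse_def Let_def x_def u_def s_def)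
      moreover have "1 + (u\<^sup>2 - s) / (u\<^sup>2 + s) = 2 * u\<^sup>2 / (u\<^sup>2 + s)"
        using pos by (simp add: field_simps)
      ultimately have "collapse m t (Suc i) / (1 + collapse m t 0) = x i / u"
        using pos u by (simp add: power2_eq_square)
      thus "(2 * t i - 1) / (1 - P t) = collapse m t (Suc i) / (1 + collapse m t 0)"
        by (simp add: x_def u_def P_def)
    qed
    have v: "(2 * t i - 1) / (1 - P t) = (2 * t' i - 1) / (1 - P t')" if "i < m" for i
      using ratio t t' False eq that by metis
    have lt1: "P t < 1" "P t' < 1" using lt[of _ 0] t t' False m by auto
    have "P t / (1 - P t) = P t' / (1 - P t')"
    proof -
      have "sup_norm m (\<lambda>i. 1 / (1 - P t) * (2 * t i - 1)) = sup_norm m (\<lambda>i. 1 / (1 - P t') * (2 * t' i - 1))"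
        by (rule sup_norm_cong) (use v in simp)
      thus ?thesis unfolding sup_norm_scale[OF m] P_def[symmetric] using lt1 by (simp add: P_def)
    qed
    hence "P t = P t'" using lt1 by (simp add: field_simps)
    with v lt1 have "t i = t' i" if "i < m" for i using that by (fastforce simp: )
    hence "t = t'" using t t' by (auto simp: topspace_cube fun_eq_iff) (metis not_less)
    thus ?thesis ..
  qed
qed (use collapse_on_boundary m in auto)

lemma collapse_in_sphere:
  assumes m: "m \<ge> 1" shows "collapse m t \<in> topspace (nsphere m)"
proof -
  define x where "x = (\<lambda>i. 2 * t i - 1)"
  define u where "u = 1 - sup_norm m x"
  define s where "s = (\<Sum>i<m. (x i)\<^sup>2)"
  have pos: "u\<^sup>2 + s > 0" using denom_pos[OF m] by (simp add: u_def s_def)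
  have "(\<Sum>i\<le>m. (collapse m t i)\<^sup>2) = ((u\<^sup>2 - s) / (u\<^sup>2 + s))\<^sup>2 + (\<Sum>i<m. (2 * u * x i / (u\<^sup>2 + s))\<^sup>2)"
    by (subst sum.atMost_shift) (simp add: collapse_def Let_def x_def u_def s_def)
  also have "(\<Sum>i<m. (2 * u * x i / (u\<^sup>2 + s))\<^sup>2) = (2 * u / (u\<^sup>2 + s))\<^sup>2 * s"
    unfolding s_def sum_distrib_left by (simp add: power_mult_distrib power_divide)
  also have "((u\<^sup>2 - s) / (u\<^sup>2 + s))\<^sup>2 + (2 * u / (u\<^sup>2 + s))\<^sup>2 * s = 
     ((u\<^sup>2 - s)\<^sup>2 + 4 * u\<^sup>2 * s) / (u\<^sup>2 + s)\<^sup>2"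
    by (simp add: power_divide power_mult_distrib add_divide_distrib)
  also have "(u\<^sup>2 - s)\<^sup>2 + 4 * u\<^sup>2 * s = (u\<^sup>2 + s)\<^sup>2" by algebra
  finally have "(\<Sum>i\<le>m. (collapse m t i)\<^sup>2) = 1" using pos by simp
  thus ?thesis by (simp add: topspace_nsphere) (simp add: collapse_def Let_def)
qed

lemma sphere_subset_collapse:
  assumes m: "m \<ge> 1" shows "topspace (nsphere m) \<subseteq> collapse m ` topspace (cube m)"
proof
  fix z assume z: "z \<in> topspace (nsphere m)"
  hence sq: "(z 0)\<^sup>2 + (\<Sum>i<m. (z (Suc i))\<^sup>2) = 1" by (simp add: topspace_nsphere sum.atMost_shift)
  show "z \<in> collapse m ` topspace (cube m)"
  proof (cases "z 0 = -1")
    case True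
    with sq have "(\<Sum>i<m. (z (Suc i))\<^sup>2) = 0" by simp
    hence "\<forall>i<m. z (Suc i) = 0" by (simp add: sum_nonneg_eq_0_iff)
    hence "z = sphere_base" using True z
      by (auto simp: sphere_base_def fun_eq_iff topspace_nsphere) (metis Suc_diff_1 Suc_less_eq not_less_eq)
    moreover have b: "(\<lambda>_. 0) \<in> cube_boundary m" using m by (auto simp: cube_boundary_def topspace_cube intro!: exI[of _ 0])
    hence "collapse m (\<lambda>_. 0) = sphere_base" using collapse_on_boundary m by blast
    ultimately show ?thesis using b by (force simp: cube_boundary_def)
  next
    case False
    have "(z 0)\<^sup>2 \<le> 1" using sq sum_nonneg[of "{..<m}" "\<lambda>i. (z (Suc i))\<^sup>2"] by simp
    hence z0: "z 0 > -1" using False by (metis abs_le_square_iff abs_le_iff abs_1 less_eq_real_def one_power2 minus_le_iff)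
    define v where "v = (\<lambda>i. z (Suc i) / (1 + z 0))"
    define M where "M = sup_norm m v"
    have M: "M \<ge> 0" using abs_le_sup_norm[of 0 m v] m by (simp add: M_def)
    define t where "t = (\<lambda>i. if i < m then (1 + v i / (1 + M)) / 2 else 0)"
    have "\<bar>v i / (1 + M)\<bar> \<le> 1" if "i < m" for i
      using abs_le_sup_norm[OF that, of v] M by (simp add: M_def)
    hence bd: "0 \<le> 1 + v i / (1 + M)" "v i / (1 + M) \<le> 1" if "i < m" for i
      using that by (smt (verit))+
    have tc: "t \<in> topspace (cube m)" using bd by (simp add: topspace_cube t_def)
    have x: "2 * t i - 1 = 1 / (1 + M) * v i" if "i < m" for i
    proof -
      have ti: "t i = (1 + v i / (1 + M)) / 2" using that by (simp only: t_def if_True)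
      show ?thesis unfolding ti using M by (simp add: field_simps)
    qed
    have N: "sup_norm m (\<lambda>i. 2 * t i - 1) = M / (1 + M)"
      using sup_norm_cong[of m "\<lambda>i. 2 * t i - 1" "\<lambda>i. 1 / (1 + M) * v i"] x M
      by (simp only: sup_norm_scale[OF m] M_def[symmetric]) simp
    have u: "1 - M / (1 + M) = 1 / (1 + M)" using M by (simp add: field_simps)
    define S where "S = (\<Sum>i<m. (v i)\<^sup>2)"
    have s: "(\<Sum>i<m. (2 * t i - 1)\<^sup>2) = S / (1 + M)\<^sup>2"
      unfolding S_def sum_divide_distrib by (intro sum.cong refl) (simp only: lessThan_iff x power_mult_distrib, simp add: power_divide)
    have S: "S = (1 - (z 0)\<^sup>2) / (1 + z 0)\<^sup>2"
      using sq by (simp add: S_def v_def power_divide sum_divide_distrib[symmetric] eq_diff_eq add.commute)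
    have S': "S = (1 - z 0) / (1 + z 0)" 
    proof -
      have "1 - (z 0)\<^sup>2 = (1 - z 0) * (1 + z 0)" by (simp add: power2_eq_square algebra_simps)
      thus ?thesis unfolding S power2_eq_square[of "1 + z 0"] using z0 by simp
    qed
    have S1: "1 + S = 2 / (1 + z 0)" "1 - S = 2 * z 0 / (1 + z 0)" using z0 by (simp_all add: S' field_simps)
    have den: "1 / (1 + M)\<^sup>2 + S / (1 + M)\<^sup>2 = (1 + S) / (1 + M)\<^sup>2" "1 / (1 + M)\<^sup>2 - S / (1 + M)\<^sup>2 = (1 - S) / (1 + M)\<^sup>2"
      by (simp_all add: add_divide_distrib diff_divide_distrib)
    have "collapse m t i = z i" for i
    proof -
      consider "i = 0" | j where "i = Suc j" "j < m" | "i > m" by (metis Suc_le_eq linorder_not_le not0_implies_Suc)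
      thus ?thesis
      proof cases
        case 1
        have "collapse m t 0 = (1 - S) / (1 + S)"
          unfolding collapse_def Let_def N u s using M by (simp add: power_divide den)
        thus ?thesis using 1 z0 by (simp add: S1)
      next
        case 2
        have "collapse m t (Suc j) = 2 * (1 / (1 + M)) * (1 / (1 + M) * v j) / ((1 / (1 + M))\<^sup>2 + S / (1 + M)\<^sup>2)"
          unfolding collapse_def Let_def N u s using 2 x by simp
        also have "\<dots> = 2 * (v j / (1 + M)\<^sup>2) / ((1 + S) / (1 + M)\<^sup>2)"
          unfolding power_divide one_power2 den by (simp add: power2_eq_square)
        also have "\<dots> = 2 * v j / (1 + S)" using M by simp
        also have "\<dots> = z (Suc j)" using z0 by (simp add: S1 v_def)
        finally show ?thesis using 2 by simp
      next
        case 3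
        thus ?thesis using z by (simp add: collapse_def Let_def topspace_nsphere)
      qed
    qed
    thus ?thesis using tc by (metis ext imageI)
  qed
qed

lemma sphere_map_collapse:
  assumes "m \<ge> 1" "f \<in> Omega m X x0" "t \<in> topspace (cube m)"
  shows "sphere_map m f (collapse m t) = f t"
proof -
  define t' where "t' = inv_into (topspace (cube m)) (collapse m) (collapse m t)"
  have "t' \<in> topspace (cube m)" "collapse m t' = collapse m t"
    unfolding t'_def using assms by (auto intro: inv_into_into) (metis f_inv_into_f imageI)
  hence "f t' = f t" using collapse_eq_iff[OF assms(1)] assms by (auto simp: Omega_def)
  thus ?thesis by (simp add: sphere_map_def t'_def)
qed


lemma sum_e: "n \<ge> 1 \<Longrightarrow> (\<Sum>i<n::nat. (if i = 0 then 1 else 0) * x i) = (x 0 :: real)"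
  using sum.mono_neutral_right[of "{..<n}" "{0}" "\<lambda>i. (if i = 0 then 1 else 0) * x i"] by auto

lemma sum_sq_diag_rotation:
  assumes n: "n \<ge> 1" shows "(\<Sum>i<n. (diag_rotation n x i)\<^sup>2) = (\<Sum>i<n. (x i)\<^sup>2)"
proof -
  define k where "k = 1 / sqrt (real n)"
  define e where "e = (\<lambda>i::nat. if i = 0 then 1 else 0 :: real)"
  define S where "S = (\<Sum>i<n. x i)"
  define c where "c = (\<Sum>i<n. (e i + k) * x i) / (1 + k)"
  have k: "k > 0" and nk: "real n * k\<^sup>2 = 1" using n by (auto simp: k_def power_divide)
  have se: "(\<Sum>i<n. e i * y i) = y 0" for y using sum_e[OF n] by (simp add: e_def)
  have se1: "(\<Sum>i<n. e i) = 1" using se[of "\<lambda>_. 1"] by simp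
  have c: "c * (1 + k) = x 0 + k * S"
  proof -
    have "c * (1 + k) = (\<Sum>i<n. (e i + k) * x i)" using k by (simp add: c_def)
    thus ?thesis by (simp add: S_def distrib_right sum.distrib se sum_distrib_left)
  qed
  have "(\<Sum>i<n. (diag_rotation n x i)\<^sup>2) = (\<Sum>i<n. (x i - c * (e i + k) + 2 * x 0 * k)\<^sup>2)"
    by (simp add: diag_rotation_def Let_def c_def e_def k_def)
  also have "\<dots> = (\<Sum>i<n. (x i)\<^sup>2 + (2 * x 0 * k - c * k) * 2 * x i + (2 * x 0 * k - c * k)\<^sup>2
        - 2 * c * (e i * x i) + c\<^sup>2 * e i - 2 * c * (2 * x 0 * k - c * k) * e i)"
    by (intro sum.cong refl) (simp add: e_def power2_eq_square algebra_simps)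
  also have "\<dots> = (\<Sum>i<n. (x i)\<^sup>2) + (2 * x 0 * k - c * k) * 2 * S + real n * (2 * x 0 * k - c * k)\<^sup>2
        - 2 * c * x 0 + c\<^sup>2 - 2 * c * (2 * x 0 * k - c * k)"
    by (simp add: sum.distrib sum_subtractf sum_distrib_left[symmetric] se se1 S_def)
  also have "real n * (2 * x 0 * k - c * k)\<^sup>2 = (real n * k\<^sup>2) * (2 * x 0 - c)\<^sup>2"
    by (simp add: power2_eq_square algebra_simps)
  also have "\<dots> = (2 * x 0 - c)\<^sup>2" by (simp add: nk)
  also have "(\<Sum>i<n. (x i)\<^sup>2) + (2 * x 0 * k - c * k) * 2 * S + (2 * x 0 - c)\<^sup>2
        - 2 * c * x 0 + c\<^sup>2 - 2 * c * (2 * x 0 * k - c * k) = (\<Sum>i<n. (x i)\<^sup>2)"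
    using c by algebra
  finally show ?thesis .
qed

lemma diag_rotation_sphere_base:
  assumes n: "n \<ge> 1" and "i < n" shows "diag_rotation n sphere_base i = - 1 / sqrt (real n)"
proof -
  have "(\<Sum>i<n. ((if i = 0 then 1 else 0) + 1 / sqrt (real n)) * sphere_base i) = - (1 + 1 / sqrt (real n))"
    by (subst sum.cong[OF refl, of _ _ "\<lambda>i. if i = 0 then - (1 + 1 / sqrt (real n)) else 0"])
       (use n in \<open>auto simp: sphere_base_def sum.delta\<close>)
  moreover have "1 + 1 / sqrt (real n) > 0" by (simp add: add_pos_nonneg)
  ultimately have c: "(\<Sum>i<n. ((if i = 0 then 1 else 0) + 1 / sqrt (real n)) * sphere_base i)
      / (1 + 1 / sqrt (real n)) = - 1" by (metis divide_self less_irrefl minus_divide_left)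
  show ?thesis unfolding diag_rotation_def Let_def c using assms
    by (simp add: sphere_base_def)
qed

lemma sphere_to_cube_boundary_in:
  assumes n: "n \<ge> 1" and z: "z \<in> topspace (nsphere (n - 1))"
  shows "sphere_to_cube_boundary n z \<in> cube_boundary n"
proof -
  define y where "y = diag_rotation n z"
  have "{..n - 1} = {..<n}" using n by auto
  hence "(\<Sum>i<n. (y i)\<^sup>2) = 1"
    using z sum_sq_diag_rotation[OF n] by (simp add: y_def topspace_nsphere)
  hence "\<exists>i\<in>{..<n}. (y i)\<^sup>2 \<noteq> 0" by (metis sum.neutral zero_neq_one)
  then obtain i where "i < n" "y i \<noteq> 0" by auto
  hence N: "sup_norm n y > 0" using abs_le_sup_norm[of i n y] by simp
  have le: "\<bar>y i / sup_norm n y\<bar> \<le> 1" if "i < n" for i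
    using abs_le_sup_norm[OF that, of y] N by simp
  hence bd: "0 \<le> 1 + y i / sup_norm n y" "y i / sup_norm n y \<le> 1" if "i < n" for i
    using that by (smt (verit))+
  have "sphere_to_cube_boundary n z \<in> topspace (cube n)"
    using bd by (simp add: topspace_cube sphere_to_cube_boundary_def Let_def y_def[symmetric])
  moreover obtain j where "j < n" "sup_norm n y = \<bar>y j\<bar>" using sup_norm_attained[OF n] by metis
  hence "sphere_to_cube_boundary n z j = 0 \<or> sphere_to_cube_boundary n z j = 1"
    using N by (auto simp: sphere_to_cube_boundary_def y_def[symmetric] Let_def abs_if)
  ultimately show ?thesis using \<open>j < n\<close> by (auto simp: cube_boundary_def)
qed

lemma attaching_map_in_wedge:
  assumes "p \<ge> 1" "q \<ge> 1" and z: "z \<in> topspace (nsphere (p + q - 1))"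
  shows "attaching_map p q z \<in> topspace (sphere_wedge p q)"
proof -
  define t where "t = sphere_to_cube_boundary (p + q) z"
  have t: "t \<in> cube_boundary (p + q)"
    unfolding t_def using assms by (intro sphere_to_cube_boundary_in) auto
  have c: "fst_coords p t \<in> topspace (cube p)" "snd_coords p q t \<in> topspace (cube q)"
    using t by (auto simp: cube_boundary_def topspace_cube fst_coords_def snd_coords_def)
  obtain i where i: "i < p + q" "t i = 0 \<or> t i = 1" using t by (auto simp: cube_boundary_def)
  have "fst_coords p t \<in> cube_boundary p \<or> snd_coords p q t \<in> cube_boundary q"
  proof (cases "i < p")
    case True
    thus ?thesis using i c by (auto simp: cube_boundary_def fst_coords_def)
  next
    case False
    hence "i - p < q" "p + (i - p) = i" using i by auto
    hence "snd_coords p q t (i - p) = 0 \<or> snd_coords p q t (i - p) = 1"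
      using i by (simp add: snd_coords_def)
    thus ?thesis using c \<open>i - p < q\<close> by (auto simp: cube_boundary_def)
  qed
  thus ?thesis using assms collapse_in_sphere collapse_on_boundary
    by (auto simp: sphere_wedge_def attaching_map_def Let_def t_def[symmetric])
qed

lemma attaching_map_sphere_base:
  assumes "p \<ge> 1" "q \<ge> 1"
  shows "attaching_map p q sphere_base = (sphere_base, sphere_base)"
proof -
  have n: "p + q \<ge> 1" using assms by simp
  define y where "y = diag_rotation (p + q) sphere_base"
  have y: "y i = - 1 / sqrt (real (p + q))" if "i < p + q" for i
    using diag_rotation_sphere_base[OF n that] by (simp add: y_def)
  have "sup_norm (p + q) y = 1 / sqrt (real (p + q))"
    by (rule sup_norm_attained[OF n, of y]) (use y in simp)
  hence "sphere_to_cube_boundary (p + q) sphere_base = (\<lambda>_. 0)"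
    using y n by (auto simp: sphere_to_cube_boundary_def Let_def y_def[symmetric] fun_eq_iff)
  moreover have "(\<lambda>_. 0) \<in> cube_boundary m" if "m \<ge> 1" for m
    using that by (auto simp: cube_boundary_def topspace_cube intro!: exI[of _ 0])
  ultimately show ?thesis using assms collapse_on_boundary
    by (simp add: attaching_map_def Let_def fst_coords_def snd_coords_def)
qed

end

theory Submission
  imports Defs
begin

text \<open>
  Write \<open>n = p + q\<close>, let \<open>R\<close> be the diagonal rotation and let \<open>\<tau>\<close> be the orthogonal map of \<open>R\<^sup>n\<close>
  interchanging the two blocks of coordinates. Then \<open>[g,f] = \<Phi> \<circ> R\<close> and \<open>[f,g] = \<Phi> \<circ> \<tau> \<circ> R\<close> on
  \<open>S\<^sup>n\<^sup>-\<^sup>1\<close> for a single map \<open>\<Phi> : S\<^sup>n\<^sup>-\<^sup>1 \<rightarrow> X\<close>, while changing the sign of a loop amounts to precomposing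
  with a reflection of the sphere that fixes the base point. The map \<open>\<tau>\<close> is a product of \<open>p (n - 1)\<close>
  transpositions, each a reflection fixing the diagonal, and any two reflections fixing a point \<open>b\<close>
  are homotopic through such reflections. As \<open>p (n - 1)\<close> and \<open>pq\<close> have the same parity, \<open>\<tau>\<close> is homotopic
  relative to the base point to the \<open>pq\<close>-th power of a reflection. All of these are self-maps of the
  sphere followed by \<open>\<Phi>\<close>, and both ends of the homotopy are surjective before \<open>\<Phi>\<close> is applied, so no
  point outside the common image is ever visited.
\<close>

section \<open>Reflections\<close>

definition dot :: "nat \<Rightarrow> (nat \<Rightarrow> real) \<Rightarrow> (nat \<Rightarrow> real) \<Rightarrow> real" where
  "dot n x y = (\<Sum>i<n. x i * y i)"

text \<open>For \<open>dot n u u = 0\<close> this is the identity, since division by zero yields zero.\<close>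

definition reflect :: "nat \<Rightarrow> (nat \<Rightarrow> real) \<Rightarrow> (nat \<Rightarrow> real) \<Rightarrow> nat \<Rightarrow> real" where
  "reflect n u x = (\<lambda>i. x i - 2 * dot n u x / dot n u u * u i)"

lemma dot_commute: "dot n x y = dot n y x"
  by (simp add: dot_def mult.commute)

lemma dot_add_right: "dot n x (\<lambda>i. y i + z i) = dot n x y + dot n x z"
  by (simp add: dot_def distrib_left sum.distrib)

lemma dot_diff_right: "dot n x (\<lambda>i. y i - z i) = dot n x y - dot n x z"
  by (simp add: dot_def right_diff_distrib sum_subtractf)

lemma dot_scale_right: "dot n x (\<lambda>i. a * y i) = a * dot n x y"
  by (simp add: dot_def sum_distrib_left mult.left_commute)

lemma dot_add_left: "dot n (\<lambda>i. y i + z i) x = dot n y x + dot n z x"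
  by (metis dot_commute dot_add_right)

lemma dot_diff_left: "dot n (\<lambda>i. y i - z i) x = dot n y x - dot n z x"
  by (metis dot_commute dot_diff_right)

lemma dot_scale_left: "dot n (\<lambda>i. a * y i) x = a * dot n y x"
  by (metis dot_commute dot_scale_right)

lemmas dot_linear = dot_add_right dot_diff_right dot_scale_right
  dot_add_left dot_diff_left dot_scale_left

lemma dot_self_eq_0_iff: "dot n x x = 0 \<longleftrightarrow> (\<forall>i<n. x i = 0)"
  by (auto simp: dot_def sum_nonneg_eq_0_iff)

lemma dot_unit: "a < n \<Longrightarrow> dot n (\<lambda>i. if i = a then 1 else 0) x = x a"
  by (simp add: dot_def if_distrib[of "\<lambda>c. c * _"] cong: if_cong)

lemma dot_reflect: "dot n (reflect n u x) (reflect n u y) = dot n x y"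
proof (cases "dot n u u = 0")
  case False
  then show ?thesis
    unfolding reflect_def dot_linear by (simp add: dot_commute[of n x u] field_simps)
qed (simp add: reflect_def)

lemma reflect_reflect: "reflect n u (reflect n u x) = x"
proof (cases "dot n u u = 0")
  case False
  then have "dot n u (reflect n u x) = - dot n u x"
    unfolding reflect_def dot_linear by simp
  then show ?thesis by (simp add: reflect_def[of n u "reflect n u x"]) (simp add: reflect_def)
qed (simp add: reflect_def)

lemma reflect_orthogonal: "dot n u x = 0 \<Longrightarrow> reflect n u x = x"
  by (simp add: reflect_def)

lemma reflect_scale: "c \<noteq> 0 \<Longrightarrow> reflect n (\<lambda>i. c * u i) x = reflect n u x"
  by (auto simp: reflect_def dot_linear fun_eq_iff)

text \<open>A reflection is a linear isometry, so conjugating by it only moves the axis. This later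
  carries the sign reflection of a loop through the diagonal rotation.\<close>

lemma reflect_conjugate:
  "reflect n w (reflect n u x) = reflect n (reflect n w u) (reflect n w x)"
  unfolding reflect_def[of n "reflect n w u"] dot_reflect
  unfolding reflect_def dot_linear
  by (auto simp: fun_eq_iff algebra_simps diff_divide_distrib add_divide_distrib)

section \<open>The sphere in coordinates and continuity of reflections\<close>

lemma topspace_nsphere_dot:
  assumes "n \<ge> 1"
  shows "x \<in> topspace (nsphere (n - 1)) \<longleftrightarrow> (\<forall>i\<ge>n. x i = 0) \<and> dot n x x = 1"
proof -
  have "{..n - 1} = {..<n}" using assms by auto
  moreover have "i > n - 1 \<longleftrightarrow> i \<ge> n" for i using assms by auto
  ultimately show ?thesis by (simp add: topspace_nsphere dot_def power2_eq_square)
qed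

lemma continuous_map_nsphere_iff:
  "continuous_map Z (nsphere m) h \<longleftrightarrow>
    (\<forall>i. continuous_map Z euclideanreal (\<lambda>z. h z i)) \<and> h \<in> topspace Z \<rightarrow> topspace (nsphere m)"
  by (auto simp: nsphere_def Euclidean_space_def subtopology_subtopology
      continuous_map_in_subtopology continuous_map_componentwise_UNIV)

lemma continuous_map_cube_iff:
  "continuous_map Z (cube m) h \<longleftrightarrow>
    (\<forall>i. continuous_map Z euclideanreal (\<lambda>z. h z i)) \<and> h \<in> topspace Z \<rightarrow> topspace (cube m)"
  by (auto simp: cube_def Euclidean_space_def subtopology_subtopology
      continuous_map_in_subtopology continuous_map_componentwise_UNIV)

lemma continuous_map_reflect:
  assumes "\<And>i. continuous_map Z euclideanreal (\<lambda>z. u z i)"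
    and "\<And>i. continuous_map Z euclideanreal (\<lambda>z. x z i)"
    and "\<And>z. z \<in> topspace Z \<Longrightarrow> dot n (u z) (u z) \<noteq> 0"
  shows "continuous_map Z euclideanreal (\<lambda>z. reflect n (u z) (x z) i)"
proof -
  have dot: "continuous_map Z euclideanreal (\<lambda>z. dot n (v z) (w z))"
    if "\<And>i. continuous_map Z euclideanreal (\<lambda>z. v z i)"
      and "\<And>i. continuous_map Z euclideanreal (\<lambda>z. w z i)" for v w
    unfolding dot_def by (intro continuous_intros that) auto
  show ?thesis
    unfolding reflect_def by (intro continuous_intros assms dot)
qed

lemma reflect_in_nsphere:
  assumes "n \<ge> 1" "x \<in> topspace (nsphere (n - 1))" "\<forall>i\<ge>n. u i = 0"
  shows "reflect n u x \<in> topspace (nsphere (n - 1))"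
  using assms unfolding topspace_nsphere_dot[OF assms(1)] dot_reflect
  by (simp add: reflect_def)

section \<open>Based homotopies between reflections\<close>

abbreviation based_homotopic where
  "based_homotopic n b \<equiv> homotopic_with (\<lambda>k. k b = b) (nsphere (n - 1)) (nsphere (n - 1))"

text \<open>The axis moves along the straight segment from \<open>u\<close> to \<open>v\<close>. It
  stays orthogonal to \<open>b\<close>, so \<open>b\<close> is fixed throughout, and
  \<open>nz\<close> keeps the quotient in \<open>reflect\<close> continuous.\<close>

lemma reflect_homotopic_segment:
  assumes n: "n \<ge> 1" and u: "\<forall>i\<ge>n. u i = 0" "dot n u b = 0"
    and v: "\<forall>i\<ge>n. v i = 0" "dot n v b = 0"
    and nz: "\<And>s. s \<in> {0..1} \<Longrightarrow>
      dot n (\<lambda>i. (1 - s) * u i + s * v i) (\<lambda>i. (1 - s) * u i + s * v i) \<noteq> 0"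
  shows "based_homotopic n b (reflect n u) (reflect n v)"
proof -
  let ?w = "\<lambda>s i. (1 - s) * u i + s * v i"
  let ?Z = "prod_topology (top_of_set {0..1::real}) (nsphere (n - 1))"
  have fst: "continuous_map ?Z euclideanreal fst"
    using continuous_map_fst continuous_map_into_fulltopology by blast
  have snd: "continuous_map ?Z euclideanreal (\<lambda>z. snd z i)" for i
    using continuous_map_nsphere_iff continuous_map_snd by blast
  have "continuous_map ?Z (nsphere (n - 1)) (\<lambda>z. reflect n (?w (fst z)) (snd z))"
    unfolding continuous_map_nsphere_iff
  proof (intro conjI allI funcsetI continuous_map_reflect)
    fix i show "continuous_map ?Z euclideanreal (\<lambda>z. ?w (fst z) i)"
      by (intro continuous_intros fst)
  next
    fix z assume "z \<in> topspace ?Z"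
    then show "dot n (?w (fst z)) (?w (fst z)) \<noteq> 0"
      and "reflect n (?w (fst z)) (snd z) \<in> topspace (nsphere (n - 1))"
      using nz u v by (auto intro!: reflect_in_nsphere[OF n, simplified])
  qed (rule snd)
  moreover have "dot n (?w s) b = 0" for s by (simp add: dot_linear u v)
  ultimately show ?thesis
    unfolding homotopic_with_def
    by (intro exI[of _ "\<lambda>z. reflect n (?w (fst z)) (snd z)"]) (auto simp: reflect_orthogonal)
qed

text \<open>The segment of axes can fail only by meeting zero; then one axis is a negative multiple
  of the other and both define the same reflection.\<close>

lemma reflect_homotopic:
  assumes n: "n \<ge> 1" and u: "\<forall>i\<ge>n. u i = 0" "dot n u b = 0" "dot n u u \<noteq> 0"
    and v: "\<forall>i\<ge>n. v i = 0" "dot n v b = 0" "dot n v v \<noteq> 0"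
  shows "based_homotopic n b (reflect n u) (reflect n v)"
proof (cases "\<exists>s\<in>{0..1}. dot n (\<lambda>i. (1 - s) * u i + s * v i) (\<lambda>i. (1 - s) * u i + s * v i) = 0")
  case True
  then obtain s where s: "s \<in> {0..1}" "\<And>i. i < n \<Longrightarrow> (1 - s) * u i + s * v i = 0"
    by (auto simp: dot_self_eq_0_iff)
  then have eq: "(1 - s) * u i = - s * v i" for i
    using u v by (cases "i < n") (auto simp: add_eq_0_iff)
  have "s \<noteq> 1" "s \<noteq> 0" using eq u v by (auto simp: dot_self_eq_0_iff)
  then have "u = (\<lambda>i. - s / (1 - s) * v i)" "- s / (1 - s) \<noteq> 0"
    using eq by (auto simp: fun_eq_iff field_simps)
  then have "reflect n u = reflect n v"
    using reflect_scale by (metis ext)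
  \<comment> \<open>The constant segment gives reflexivity together with continuity of
    \<open>reflect n v\<close>.\<close>
  moreover have "based_homotopic n b (reflect n v) (reflect n v)"
    using reflect_homotopic_segment[OF n v(1,2) v(1,2)] v(3) by (simp add: algebra_simps)
  ultimately show ?thesis by simp
qed (use assms reflect_homotopic_segment in blast)

text \<open>The standard representative of the based homotopy class of a product of \<open>e\<close> reflections.\<close>

definition reflect_power :: "nat \<Rightarrow> (nat \<Rightarrow> real) \<Rightarrow> nat \<Rightarrow> (nat \<Rightarrow> real) \<Rightarrow> nat \<Rightarrow> real" where
  "reflect_power n v e = (if even e then id else reflect n v)"

lemma reflect_power_add: "reflect_power n v d \<circ> reflect_power n v e = reflect_power n v (d + e)"
  by (auto simp: reflect_power_def reflect_reflect fun_eq_iff)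

text \<open>One factor is deformed at a time; the exponents add because a reflection is an
  involution.\<close>

lemma based_homotopic_compose:
  assumes "based_homotopic n b h (reflect_power n v d)" "based_homotopic n b k (reflect_power n v e)"
  shows "based_homotopic n b (h \<circ> k) (reflect_power n v (d + e))"
proof -
  have "based_homotopic n b (h \<circ> k) (reflect_power n v d \<circ> k)"
    using assms homotopic_with_imp_continuous_maps[OF assms(2)] homotopic_with_imp_property[OF assms(2)]
    by (intro homotopic_with_compose_continuous_map_right[OF assms(1)]) auto
  moreover have "based_homotopic n b (reflect_power n v d \<circ> k) (reflect_power n v d \<circ> reflect_power n v e)"
    using homotopic_with_imp_continuous_maps[OF assms(1)] homotopic_with_imp_property[OF assms(1)]
    by (intro homotopic_with_compose_continuous_map_left[OF assms(2)]) auto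
  ultimately show ?thesis using homotopic_with_trans by (fastforce simp: reflect_power_add)
qed

section \<open>The block transposition as a product of reflections\<close>

lemma reflect_transpose:
  assumes "a < n" "c < n" "a \<noteq> c"
  shows "reflect n (\<lambda>i. (if i = a then 1 else 0) - (if i = c then 1 else 0)) x = x \<circ> Transposition.transpose a c"
  using assms unfolding reflect_def dot_linear
  by (auto simp: dot_unit fun_eq_iff Transposition.transpose_def field_simps)

text \<open>The transposition is the reflection with axis e_k - e_l, which is orthogonal to
  \<open>b\<close> because \<open>b\<close> is constant on the first \<open>n\<close> coordinates,
  as the rotated base point will be.\<close>

lemma transpose_homotopic:
  assumes n: "n \<ge> 1" and b: "\<And>i. i < n \<Longrightarrow> b i = c"
    and v: "\<forall>i\<ge>n. v i = 0" "dot n v b = 0" "dot n v v \<noteq> 0"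
    and k: "k < n" "l < n" "k \<noteq> l"
  shows "based_homotopic n b (\<lambda>x. x \<circ> Transposition.transpose k l) (reflect_power n v 1)"
proof -
  let ?u = "\<lambda>i. (if i = k then 1 else 0) - (if i = l then 1 else 0)"
  have "based_homotopic n b (reflect n ?u) (reflect n v)"
  proof (rule reflect_homotopic[OF n _ _ _ v])
    show "dot n ?u b = 0" "dot n ?u ?u \<noteq> 0"
      using k b unfolding dot_linear by (auto simp: dot_unit)
  qed (use k in auto)
  moreover have "reflect n ?u = (\<lambda>x. x \<circ> Transposition.transpose k l)"
    using reflect_transpose[OF k] by (rule ext)
  ultimately show ?thesis by (simp add: reflect_power_def)
qed

text \<open>The cycle (0 1 ... m). For \<open>m = n - 1\<close> it is addition of 1 modulo
  \<open>n\<close> on the indices below \<open>n\<close>, so its \<open>p\<close>-th power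
  interchanges the two blocks.\<close>

definition initial_cycle :: "nat \<Rightarrow> nat \<Rightarrow> nat" where
  "initial_cycle m i = (if i < m then Suc i else if i = m then 0 else i)"

lemma initial_cycle_Suc: "initial_cycle (Suc m) = Transposition.transpose 0 (Suc m) \<circ> initial_cycle m"
  by (auto simp: initial_cycle_def fun_eq_iff Transposition.transpose_def)

lemma initial_cycle_homotopic:
  assumes n: "n \<ge> 1" and b: "\<And>i. i < n \<Longrightarrow> b i = c"
    and v: "\<forall>i\<ge>n. v i = 0" "dot n v b = 0" "dot n v v \<noteq> 0"
  shows "m < n \<Longrightarrow> based_homotopic n b (\<lambda>x. x \<circ> initial_cycle m) (reflect_power n v m)"
proof (induction m)
  case 0
  have "initial_cycle 0 = id" by (auto simp: initial_cycle_def fun_eq_iff)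
  then show ?case by (simp add: reflect_power_def id_def)
next
  case (Suc m)
  \<comment> \<open>Permutations act by precomposition, which reverses the order of factors: the
    transposition acts on \<open>x\<close> first.\<close>
  have "based_homotopic n b ((\<lambda>x. x \<circ> initial_cycle m) \<circ> (\<lambda>x. x \<circ> Transposition.transpose 0 (Suc m)))
      (reflect_power n v (m + 1))"
    using Suc.IH Suc.prems
    by (intro based_homotopic_compose transpose_homotopic[OF n b v] Suc.IH) simp_all
  moreover have "(\<lambda>x. x \<circ> initial_cycle m) \<circ> (\<lambda>x. x \<circ> Transposition.transpose 0 (Suc m))
      = (\<lambda>x::nat \<Rightarrow> real. x \<circ> initial_cycle (Suc m))"
    by (simp add: initial_cycle_Suc fun_eq_iff)
  ultimately show ?case unfolding Suc_eq_plus1 by (simp only:)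
qed

lemma initial_cycle_funpow_homotopic:
  assumes n: "n \<ge> 1" and b: "\<And>i. i < n \<Longrightarrow> b i = c"
    and v: "\<forall>i\<ge>n. v i = 0" "dot n v b = 0" "dot n v v \<noteq> 0"
  shows "based_homotopic n b (\<lambda>x. x \<circ> (initial_cycle (n - 1) ^^ k)) (reflect_power n v (k * (n - 1)))"
proof (induction k)
  case 0
  then show ?case by (simp add: reflect_power_def id_def)
next
  case (Suc k)
  have "based_homotopic n b ((\<lambda>x. x \<circ> (initial_cycle (n - 1) ^^ k)) \<circ> (\<lambda>x. x \<circ> initial_cycle (n - 1)))
      (reflect_power n v (k * (n - 1) + (n - 1)))"
    using n by (intro based_homotopic_compose Suc initial_cycle_homotopic[OF n b v]) auto
  moreover have "(\<lambda>x. x \<circ> (initial_cycle (n - 1) ^^ k)) \<circ> (\<lambda>x. x \<circ> initial_cycle (n - 1))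
      = (\<lambda>x::nat \<Rightarrow> real. x \<circ> (initial_cycle (n - 1) ^^ Suc k))"
    by (simp add: fun_eq_iff)
  moreover have "Suc k * (n - 1) = k * (n - 1) + (n - 1)" by simp
  ultimately show ?case by (simp only:)
qed

lemma initial_cycle_funpow:
  assumes "i < n" shows "(initial_cycle (n - 1) ^^ k) i = (i + k) mod n"
proof (induction k)
  case (Suc k)
  have "(i + k) mod n < n" using assms by simp
  moreover from this have "(i + k) mod n < n - 1 \<or> (i + k) mod n = n - 1" by linarith
  ultimately show ?case using Suc assms by (auto simp: initial_cycle_def mod_Suc)
qed (use assms in auto)

lemma initial_cycle_funpow_ge:
  assumes "n \<ge> 1" "i \<ge> n" shows "(initial_cycle (n - 1) ^^ k) i = i"
  by (induction k) (use assms in \<open>auto simp: initial_cycle_def\<close>)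

section \<open>The diagonal rotation\<close>

text \<open>The sum e + d of the two unit vectors in \<open>diag_rotation\<close>, which bisects
  their angle.\<close>

definition diag_axis :: "nat \<Rightarrow> nat \<Rightarrow> real" where
  "diag_axis n = (\<lambda>i. if i < n then (if i = 0 then 1 else 0) + 1 / sqrt (real n) else 0)"

definition first_axis :: "nat \<Rightarrow> real" where
  "first_axis = (\<lambda>i. if i = 0 then 1 else 0)"

text \<open>The reflection in e sends e to -e, and the one in e + d sends -e to d; their product is
  the rotation taking e to d.\<close>

lemma diag_rotation_reflect:
  assumes n: "n \<ge> 1" and x: "\<forall>i\<ge>n. x i = 0"
  shows "diag_rotation n x = reflect n (diag_axis n) (reflect n first_axis x)"
proof -
  define k where "k = 1 / sqrt (real n)"
  have k: "k > 0" and nk: "real n * k\<^sup>2 = 1" using n by (auto simp: k_def power_divide)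
  have f: "dot n first_axis y = y 0" for y using n by (simp add: first_axis_def dot_unit)
  have df: "dot n (diag_axis n) first_axis = 1 + k"
    using n by (simp add: dot_commute[of n _ first_axis] f diag_axis_def k_def)
  have "dot n (diag_axis n) (diag_axis n)
      = dot n (\<lambda>i. first_axis i + k) (\<lambda>i. first_axis i + k)"
    by (simp add: dot_def diag_axis_def first_axis_def k_def)
  also have "\<dots> = 1 + 2 * k + real n * k\<^sup>2"
    using n unfolding dot_add_left dot_add_right f dot_commute[of n "\<lambda>_. k" first_axis]
    by (simp add: dot_def first_axis_def power2_eq_square)
  finally have dd: "dot n (diag_axis n) (diag_axis n) = 2 * (1 + k)" by (simp add: nk)
  \<comment> \<open>The coefficient \<open>c\<close> in \<open>diag_rotation\<close>. As e + d has
    square norm \<open>2 * (1 + k)\<close> and product \<open>1 + k\<close> with e, the second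
    reflection subtracts \<open>c - 2 * x 0\<close> times e + d.\<close>
  define c where "c = dot n (diag_axis n) x / (1 + k)"
  have r: "reflect n first_axis x = (\<lambda>i. x i - 2 * x 0 * first_axis i)"
    by (simp add: reflect_def f) (simp add: first_axis_def)
  have "2 * dot n (diag_axis n) (reflect n first_axis x) / dot n (diag_axis n) (diag_axis n) = c - 2 * x 0"
    unfolding r dot_linear dd df c_def using k by (simp add: field_simps)
  then have R: "reflect n (diag_axis n) (reflect n first_axis x)
      = (\<lambda>i. x i - 2 * x 0 * first_axis i - (c - 2 * x 0) * diag_axis n i)"
    by (simp add: reflect_def[of n "diag_axis n"]) (simp add: r)
  have c: "c = (\<Sum>i<n. ((if i = 0 then 1 else 0) + k) * x i) / (1 + k)"
    by (simp add: c_def dot_def diag_axis_def k_def)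
  have "diag_rotation n x
      = (\<lambda>i. if i < n then x i - c * ((if i = 0 then 1 else 0) + k) + 2 * x 0 * k else 0)"
    unfolding c diag_rotation_def Let_def k_def ..
  then show ?thesis
    unfolding R using n x by (auto simp: fun_eq_iff diag_axis_def first_axis_def k_def algebra_simps)
qed

text \<open>Both reflections preserve the sphere, and applying them in the opposite order inverts
  the rotation.\<close>

lemma diag_rotation_nsphere:
  assumes n: "n \<ge> 1"
  shows "diag_rotation n \<in> topspace (nsphere (n - 1)) \<rightarrow> topspace (nsphere (n - 1))"
    and "topspace (nsphere (n - 1)) \<subseteq> diag_rotation n ` topspace (nsphere (n - 1))"
proof -
  let ?S = "topspace (nsphere (n - 1))"
  have axes: "\<forall>i\<ge>n. diag_axis n i = 0" "\<forall>i\<ge>n. first_axis i = 0"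
    using n by (auto simp: diag_axis_def first_axis_def)
  have R: "diag_rotation n x = reflect n (diag_axis n) (reflect n first_axis x)" if "x \<in> ?S" for x
    using that diag_rotation_reflect[OF n] topspace_nsphere_dot[OF n] by blast
  show "diag_rotation n \<in> ?S \<rightarrow> ?S"
    using R axes by (auto simp del: One_nat_def intro!: reflect_in_nsphere[OF n])
  show "?S \<subseteq> diag_rotation n ` ?S"
  proof
    fix y assume y: "y \<in> ?S"
    let ?x = "reflect n first_axis (reflect n (diag_axis n) y)"
    have x: "?x \<in> ?S" using y axes by (intro reflect_in_nsphere[OF n])
    then have "diag_rotation n ?x = y" by (simp only: R reflect_reflect)
    then show "y \<in> diag_rotation n ` ?S" using x by force
  qed
qed

lemma continuous_map_diag_rotation:
  assumes n: "n \<ge> 1"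
  shows "continuous_map (nsphere (n - 1)) (nsphere (n - 1)) (diag_rotation n)"
  unfolding continuous_map_nsphere_iff
proof (intro conjI allI diag_rotation_nsphere[OF n])
  fix i
  have c: "continuous_map (nsphere (n - 1)) euclideanreal (\<lambda>x. x j)" for j
    using continuous_map_nsphere_projection .
  show "continuous_map (nsphere (n - 1)) euclideanreal (\<lambda>x. diag_rotation n x i)"
    unfolding diag_rotation_def Let_def
    by (cases "i < n") (auto intro!: continuous_intros c simp del: One_nat_def simp: add_nonneg_eq_0_iff)
qed

section \<open>Continuity of the product on the boundary of the cube\<close>

lemma sup_norm_Suc:
  assumes "m \<ge> 1" shows "sup_norm (Suc m) x = max \<bar>x m\<bar> (sup_norm m x)"
  using assms unfolding sup_norm_def lessThan_Suc image_insert
  by (intro Max_insert) (auto simp: lessThan_empty_iff)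

lemma continuous_map_sup_norm:
  assumes "m \<ge> 1" and h: "\<And>i. continuous_map Z euclideanreal (\<lambda>z. h z i)"
  shows "continuous_map Z euclideanreal (\<lambda>z. sup_norm m (h z))"
  using assms(1)
proof (induction m rule: dec_induct)
  case base
  show ?case by (simp add: sup_norm_def lessThan_Suc continuous_map_real_abs h)
next
  case (step m)
  then show ?case by (simp add: sup_norm_Suc) (intro continuous_intros h)
qed

lemma sup_norm_pos:
  assumes n: "n \<ge> 1" and "y \<in> topspace (nsphere (n - 1))"
  shows "sup_norm n y > 0"
proof -
  have "dot n y y \<noteq> 0" using assms(2) unfolding topspace_nsphere_dot[OF n] by simp
  then obtain i where "i < n" "y i \<noteq> 0" by (auto simp: dot_self_eq_0_iff)
  then show ?thesis using abs_le_sup_norm[of i n y] by simp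
qed

text \<open>The radial part of \<open>sphere_to_cube_boundary\<close>, separated from the rotation
  so that a permutation of coordinates can be inserted between the two.\<close>

definition cube_projection :: "nat \<Rightarrow> (nat \<Rightarrow> real) \<Rightarrow> nat \<Rightarrow> real" where
  "cube_projection n y = (\<lambda>i. if i < n then (1 + y i / sup_norm n y) / 2 else 0)"

lemma sphere_to_cube_boundary_eq:
  "sphere_to_cube_boundary n z = cube_projection n (diag_rotation n z)"
  by (simp add: sphere_to_cube_boundary_def cube_projection_def Let_def)

text \<open>The rotation is onto the sphere, so the known fact about the composite suffices.\<close>

lemma cube_projection_in:
  assumes n: "n \<ge> 1" and "y \<in> topspace (nsphere (n - 1))"
  shows "cube_projection n y \<in> cube_boundary n"
proof -
  obtain z where "z \<in> topspace (nsphere (n - 1))" "y = diag_rotation n z"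
    using diag_rotation_nsphere(2)[OF n] assms by blast
  then show ?thesis
    using sphere_to_cube_boundary_in[OF n] by (simp only: sphere_to_cube_boundary_eq[symmetric])
qed

lemma continuous_map_cube_projection:
  assumes n: "n \<ge> 1"
  shows "continuous_map (nsphere (n - 1)) (subtopology (cube n) (cube_boundary n)) (cube_projection n)"
  unfolding continuous_map_in_subtopology continuous_map_cube_iff
proof (intro conjI allI funcsetI)
  fix i
  have c: "continuous_map (nsphere (n - 1)) euclideanreal (\<lambda>x. x j)" for j
    using continuous_map_nsphere_projection .
  have "sup_norm n y \<noteq> 0" if "y \<in> topspace (nsphere (n - 1))" for y
    using sup_norm_pos[OF n that] by simp
  then show "continuous_map (nsphere (n - 1)) euclideanreal (\<lambda>y. cube_projection n y i)"
    unfolding cube_projection_def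
    by (cases "i < n") (auto intro!: continuous_intros c continuous_map_sup_norm[OF n] simp del: One_nat_def)
qed (use cube_projection_in[OF n] in \<open>auto simp: cube_boundary_def\<close>)

text \<open>
  On the boundary of \<open>I\<^sup>p\<^sup>+\<^sup>q\<close> the larger of the two sup norms is \<open>1\<close>, so that comparing them
  selects the closed pieces \<open>I\<^sup>p \<times> \<partial>I\<^sup>q\<close> and \<open>\<partial>I\<^sup>p \<times> I\<^sup>q\<close>.
\<close>

definition cross_map ::
  "nat \<Rightarrow> nat \<Rightarrow> ((nat \<Rightarrow> real) \<Rightarrow> 'a) \<Rightarrow> ((nat \<Rightarrow> real) \<Rightarrow> 'a) \<Rightarrow> (nat \<Rightarrow> real) \<Rightarrow> 'a" where
  "cross_map p q f g t =
    (if sup_norm p (\<lambda>i. 2 * fst_coords p t i - 1) \<le> sup_norm q (\<lambda>i. 2 * snd_coords p q t i - 1)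
     then f (fst_coords p t) else g (snd_coords p q t))"

lemma coords_in_cube:
  assumes "t \<in> topspace (cube (p + q))"
  shows "fst_coords p t \<in> topspace (cube p)" "snd_coords p q t \<in> topspace (cube q)"
  using assms by (auto simp: topspace_cube fst_coords_def snd_coords_def)

lemma coords_boundary:
  assumes "t \<in> cube_boundary (p + q)"
  shows "fst_coords p t \<in> cube_boundary p \<or> snd_coords p q t \<in> cube_boundary q"
proof -
  have t: "t \<in> topspace (cube (p + q))" using assms by (simp add: cube_boundary_def)
  obtain i where i: "i < p + q" "t i = 0 \<or> t i = 1" using assms by (auto simp: cube_boundary_def)
  show ?thesis
  proof (cases "i < p")
    case True
    then show ?thesis using i coords_in_cube(1)[OF t] by (auto simp: cube_boundary_def fst_coords_def)
  next
    case False
    then have "i - p < q" "p + (i - p) = i" using i by auto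
    then show ?thesis
      using i coords_in_cube(2)[OF t]
      by (auto simp: cube_boundary_def snd_coords_def intro!: exI[of _ "i - p"])
  qed
qed

text \<open>A block on its boundary has the maximal norm 1, which decides the comparison. In a tie
  both blocks are on their boundaries and both values are \<open>x0\<close>.\<close>

lemma cross_map_boundary:
  assumes pq: "p \<ge> 1" "q \<ge> 1" and f: "f \<in> Omega p X x0" and g: "g \<in> Omega q X x0"
    and t: "t \<in> cube_boundary (p + q)"
  shows "snd_coords p q t \<in> cube_boundary q \<Longrightarrow> cross_map p q f g t = f (fst_coords p t)"
    and "fst_coords p t \<in> cube_boundary p \<Longrightarrow> cross_map p q f g t = g (snd_coords p q t)"
proof -
  have c: "fst_coords p t \<in> topspace (cube p)" "snd_coords p q t \<in> topspace (cube q)"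
    using t coords_in_cube by (auto simp: cube_boundary_def)
  note N = cube_boundary_iff_sup_norm[OF pq(1) c(1)] cube_boundary_iff_sup_norm[OF pq(2) c(2)]
  show "cross_map p q f g t = f (fst_coords p t)" if "snd_coords p q t \<in> cube_boundary q"
    using that N by (simp add: cross_map_def)
  show "cross_map p q f g t = g (snd_coords p q t)" if b: "fst_coords p t \<in> cube_boundary p"
  proof (cases "snd_coords p q t \<in> cube_boundary q")
    case True
    then show ?thesis using b f g N by (simp add: cross_map_def Omega_def)
  next
    case False
    then show ?thesis using b N by (simp add: cross_map_def)
  qed
qed

text \<open>The two branches are glued along the locus of equal norms. There both norms are 1, since
  one of them always is, and \<open>f\<close> and \<open>g\<close> agree with value
  \<open>x0\<close>.\<close>

lemma continuous_map_cross_map: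
  assumes pq: "p \<ge> 1" "q \<ge> 1" and f: "f \<in> Omega p X x0" and g: "g \<in> Omega q X x0"
  shows "continuous_map (subtopology (cube (p + q)) (cube_boundary (p + q))) X (cross_map p q f g)"
proof -
  let ?B = "subtopology (cube (p + q)) (cube_boundary (p + q))"
  have coord: "continuous_map ?B euclideanreal (\<lambda>t. t i)" for i
    using continuous_map_cube_iff[of "cube (p + q)" "p + q" "\<lambda>t. t"]
    by (simp add: continuous_map_from_subtopology)
  have B: "t \<in> topspace (cube (p + q))" if "t \<in> topspace ?B" for t using that by simp
  have fst: "continuous_map ?B euclideanreal (\<lambda>t. fst_coords p t i)" for i
    unfolding fst_coords_def by (cases "i < p") (auto intro: coord)
  have snd: "continuous_map ?B euclideanreal (\<lambda>t. snd_coords p q t i)" for i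
    unfolding snd_coords_def by (cases "i < q") (auto intro: coord)
  have "continuous_map ?B (cube p) (fst_coords p)" "continuous_map ?B (cube q) (snd_coords p q)"
    unfolding continuous_map_cube_iff using fst snd coords_in_cube[OF B] by auto
  then have "continuous_map ?B X (f \<circ> fst_coords p)" "continuous_map ?B X (g \<circ> snd_coords p q)"
    using f g by (auto simp: Omega_def intro: continuous_map_compose)
  moreover have "f (fst_coords p t) = g (snd_coords p q t)"
    if t: "t \<in> topspace ?B"
      and eq: "sup_norm p (\<lambda>i. 2 * fst_coords p t i - 1) = sup_norm q (\<lambda>i. 2 * snd_coords p q t i - 1)" for t
  proof -
    have "t \<in> cube_boundary (p + q)" using t by simp
    moreover note N = cube_boundary_iff_sup_norm(1)[OF pq(1) coords_in_cube(1)[OF B[OF t]]]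
      cube_boundary_iff_sup_norm(1)[OF pq(2) coords_in_cube(2)[OF B[OF t]]]
    ultimately have "fst_coords p t \<in> cube_boundary p" "snd_coords p q t \<in> cube_boundary q"
      using coords_boundary eq by auto
    then show ?thesis using f g by (simp add: Omega_def)
  qed
  moreover have "continuous_map ?B euclideanreal (\<lambda>t. sup_norm p (\<lambda>i. 2 * fst_coords p t i - 1))"
    "continuous_map ?B euclideanreal (\<lambda>t. sup_norm q (\<lambda>i. 2 * snd_coords p q t i - 1))"
    by (intro continuous_map_sup_norm pq continuous_intros fst snd)+
  ultimately show ?thesis
    unfolding cross_map_def o_def
    by (intro continuous_map_cases_le) (blast intro: continuous_map_from_subtopology)+
qed

text \<open>The case split in \<open>wedge_map\<close> asks exactly whether the second block is on
  its boundary. Replacing it by \<open>cross_map\<close> removes the chosen preimages in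
  \<open>sphere_map\<close> and makes continuity accessible.\<close>

lemma wedge_map_cross_map:
  assumes pq: "p \<ge> 1" "q \<ge> 1" and f: "f \<in> Omega p X x0" and g: "g \<in> Omega q X x0"
    and t: "t \<in> cube_boundary (p + q)"
  shows "wedge_map (sphere_map p f) (sphere_map q g)
      (collapse p (fst_coords p t), collapse q (snd_coords p q t)) = cross_map p q f g t"
proof -
  have c: "fst_coords p t \<in> topspace (cube p)" "snd_coords p q t \<in> topspace (cube q)"
    using t coords_in_cube by (auto simp: cube_boundary_def)
  show ?thesis
    using cross_map_boundary[OF assms] coords_boundary[OF t] collapse_eq_base_iff[OF pq(2) c(2)]
      sphere_map_collapse[OF pq(1) f c(1)] sphere_map_collapse[OF pq(2) g c(2)]
    by (auto simp: wedge_map_def)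
qed

text \<open>Precomposing with \<open>\<sigma>\<close> puts the last \<open>q\<close> coordinates
  before the first \<open>p\<close>. The two cross maps break ties oppositely, so the values are
  compared through the boundary cases.\<close>

lemma cross_map_swap:
  assumes pq: "p \<ge> 1" "q \<ge> 1" and f: "f \<in> Omega p X x0" and g: "g \<in> Omega q X x0"
    and t: "t \<in> cube_boundary (p + q)"
  defines "\<sigma> \<equiv> initial_cycle (p + q - 1) ^^ p"
  assumes t': "t \<circ> \<sigma> \<in> cube_boundary (p + q)"
  shows "cross_map q p g f (t \<circ> \<sigma>) = cross_map p q f g t"
proof -
  have \<sigma>: "\<sigma> i = (i + p) mod (p + q)" if "i < p + q" for i
    unfolding \<sigma>_def using initial_cycle_funpow[OF that] by simp
  have "(q + i + p) mod (p + q) = i" if "i < p" for i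
    using that mod_add_self2[of i "p + q"] by (simp add: ac_simps)
  then have c: "fst_coords q (t \<circ> \<sigma>) = snd_coords p q t" "snd_coords q p (t \<circ> \<sigma>) = fst_coords p t"
    by (auto simp: fst_coords_def snd_coords_def fun_eq_iff \<sigma> add.commute)
  show ?thesis
    using cross_map_boundary[OF pq f g t] coords_boundary[OF t]
      cross_map_boundary[OF pq(2,1) g f, of "t \<circ> \<sigma>"] t'
    unfolding c by (auto simp: add.commute)
qed

section \<open>Radial projection commutes with the block permutation\<close>

lemma sup_norm_permute:
  assumes "\<sigma> ` {..<n} = {..<n}" shows "sup_norm n (x \<circ> \<sigma>) = sup_norm n x"
proof -
  have "(\<lambda>i. \<bar>(x \<circ> \<sigma>) i\<bar>) ` {..<n} = (\<lambda>i. \<bar>x i\<bar>) ` \<sigma> ` {..<n}" by (simp add: image_image)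
  then show ?thesis by (simp add: sup_norm_def assms)
qed

lemma initial_cycle_funpow_image:
  assumes "n \<ge> 1" shows "(initial_cycle (n - 1) ^^ k) ` {..<n} = {..<n}"
proof (induction k)
  case (Suc k)
  have "initial_cycle (n - 1) ` {..<n} = {..<n}"
  proof (intro subset_antisym subsetI)
    fix j assume "j \<in> {..<n}"
    then have "j = initial_cycle (n - 1) (if j = 0 then n - 1 else j - 1)"
      "(if j = 0 then n - 1 else j - 1) < n"
      using assms by (auto simp: initial_cycle_def)
    then show "j \<in> initial_cycle (n - 1) ` {..<n}" by blast
  qed (use assms in \<open>auto simp: initial_cycle_def split: if_splits\<close>)
  then show ?case by (metis Suc funpow.simps(2) image_comp)
qed simp

lemma cube_projection_cycle:
  fixes k
  assumes n: "n \<ge> 1"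
  defines "\<sigma> \<equiv> initial_cycle (n - 1) ^^ k"
  shows "cube_projection n (y \<circ> \<sigma>) = cube_projection n y \<circ> \<sigma>"
proof -
  have "\<sigma> i < n \<longleftrightarrow> i < n" for i
    using initial_cycle_funpow_ge[OF n, of i k] initial_cycle_funpow_image[OF n, of k]
    by (cases "i < n") (auto simp: \<sigma>_def)
  moreover have "sup_norm n (y \<circ> \<sigma>) = sup_norm n y"
    using sup_norm_permute initial_cycle_funpow_image[OF n] by (simp add: \<sigma>_def)
  ultimately show ?thesis by (auto simp: cube_projection_def fun_eq_iff)
qed

section \<open>Commutation of the two products\<close>

text \<open>Whatever preimage is chosen, \<open>collapse\<close> sends it back to \<open>z\<close>,
  so \<open>h\<close> may be arbitrary.\<close>

lemma sphere_map_comp_collapse: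
  assumes "m \<ge> 1" "z \<in> topspace (nsphere m)"
  shows "sphere_map m (h \<circ> collapse m) z = h z"
  using assms sphere_subset_collapse[OF assms(1)] by (auto simp: sphere_map_def f_inv_into_f)

lemma sup_norm_abs_cong: "(\<And>i. i < m \<Longrightarrow> \<bar>x i\<bar> = \<bar>y i\<bar>) \<Longrightarrow> sup_norm m x = sup_norm m y"
  by (auto simp: sup_norm_def intro!: arg_cong[where f = Max] image_cong)

text \<open>Cube coordinate \<open>i\<close> becomes sphere coordinate \<open>i + 1\<close>, so
  reversing coordinate 0 of the loop is a reflection in axis 1. The norm and the sum of squares do
  not change.\<close>

lemma collapse_neg:
  assumes "n \<ge> 2"
  shows "collapse (n - 1) (t(0 := 1 - t 0)) = reflect n (\<lambda>i. if i = 1 then 1 else 0) (collapse (n - 1) t)"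
proof -
  let ?t = "t(0 := 1 - t 0)"
  have abs: "\<bar>2 * ?t i - 1\<bar> = \<bar>2 * t i - 1\<bar>" for i by (simp add: abs_minus_commute)
  have "sup_norm (n - 1) (\<lambda>i. 2 * ?t i - 1) = sup_norm (n - 1) (\<lambda>i. 2 * t i - 1)"
    using abs by (intro sup_norm_abs_cong)
  moreover have "(2 * ?t i - 1)\<^sup>2 = (2 * t i - 1)\<^sup>2" for i
    using abs by (metis power2_abs)
  ultimately have "collapse (n - 1) ?t i = (if i = 1 then - collapse (n - 1) t i else collapse (n - 1) t i)" for i
    using assms unfolding collapse_def Let_def by (auto simp: algebra_simps minus_divide_left simp del: fun_upd_apply)
      (auto simp: algebra_simps minus_divide_left)
  then show ?thesis
    using assms by (auto simp: reflect_def dot_unit fun_eq_iff)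
qed

lemma sphere_map_sign_loop:
  assumes n: "n \<ge> 2" and z: "z \<in> topspace (nsphere (n - 1))"
  shows "sphere_map (n - 1) (sign_loop e (h \<circ> collapse (n - 1))) z
    = h (reflect_power n (\<lambda>i. if i = 1 then 1 else 0) e z)"
proof (cases "even e")
  case True
  moreover have "sphere_map (n - 1) (h \<circ> collapse (n - 1)) z = h z"
    using n by (intro sphere_map_comp_collapse z) auto
  ultimately show ?thesis by (simp add: sign_loop_def reflect_power_def)
next
  case False
  let ?r = "reflect n (\<lambda>i. if i = 1 then 1 else 0)"
  have "neg_loop (h \<circ> collapse (n - 1)) = (h \<circ> ?r) \<circ> collapse (n - 1)"
    unfolding neg_loop_def comp_def collapse_neg[OF n] ..
  moreover have "sphere_map (n - 1) ((h \<circ> ?r) \<circ> collapse (n - 1)) z = (h \<circ> ?r) z"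
    using n by (intro sphere_map_comp_collapse z) auto
  ultimately show ?thesis using False by (simp add: sign_loop_def reflect_power_def)
qed

text \<open>Conjugation passes through the two reflections composing the rotation in turn.\<close>

lemma diag_rotation_reflect_power:
  assumes n: "n \<ge> 1" and x: "\<forall>i\<ge>n. x i = 0" and u: "\<forall>i\<ge>n. u i = 0"
  shows "diag_rotation n (reflect_power n u e x) = reflect_power n (diag_rotation n u) e (diag_rotation n x)"
proof -
  have "\<forall>i\<ge>n. reflect n u x i = 0" using x u by (simp add: reflect_def)
  then show ?thesis
    using reflect_conjugate[of n first_axis u x]
      reflect_conjugate[of n "diag_axis n" "reflect n first_axis u" "reflect n first_axis x"]
    by (simp add: reflect_power_def diag_rotation_reflect[OF n] x u)
qed

lemma diag_rotation_dot:
  assumes "n \<ge> 1" "\<forall>i\<ge>n. x i = 0" "\<forall>i\<ge>n. y i = 0"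
  shows "dot n (diag_rotation n x) (diag_rotation n y) = dot n x y"
  using assms by (simp add: diag_rotation_reflect dot_reflect)

theorem proposition3p10:
  fixes X :: "'a topology" and x0 :: 'a and p q :: nat
    and f g :: "(nat \<Rightarrow> real) \<Rightarrow> 'a"
  assumes "p \<ge> 2" and "q \<ge> 2"
    and "Hausdorff_space X" and "x0 \<in> topspace X"
    and "f \<in> Omega p X x0" and "g \<in> Omega q X x0"
  shows "ir_homotopic (nsphere (p + q - 1)) sphere_base X x0
           (sphere_map (p + q - 1) (whitehead p q f g))
           (sphere_map (p + q - 1) (sign_loop (p * q) (whitehead q p g f)))"
proof -
  note f = assms(5) and g = assms(6)
  define n where "n = p + q"
  have pq: "p \<ge> 1" "q \<ge> 1" and n: "n \<ge> 1" "n \<ge> 2" using assms by (auto simp: n_def)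
  let ?S = "topspace (nsphere (n - 1))"
  let ?u = "\<lambda>i::nat. if i = 1 then 1 else 0 :: real"
  \<comment> \<open>The axis of the loop sign after rotation. Orthogonality of \<open>?u\<close> to
    \<open>sphere_base\<close> becomes orthogonality of \<open>w\<close> to the rotated base point
    \<open>b\<close>.\<close>
  define w where "w = diag_rotation n ?u"
  define b where "b = diag_rotation n sphere_base"
  define \<sigma> where "\<sigma> = initial_cycle (n - 1) ^^ p"
  define \<Phi> where "\<Phi> = cross_map q p g f \<circ> cube_projection n"
  have base: "sphere_base \<in> ?S"
    using n unfolding topspace_nsphere_dot[OF n(1)]
    by (auto simp: sphere_base_def dot_def if_distrib[of "\<lambda>c. c * _"] cong: if_cong)
  have S0: "\<forall>i\<ge>n. z i = 0" if "z \<in> ?S" for z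
    using that unfolding topspace_nsphere_dot[OF n(1)] by simp
  have u0: "\<forall>i\<ge>n. ?u i = 0" using n by auto
  have R: "diag_rotation n z \<in> ?S" if "z \<in> ?S" for z
    using diag_rotation_nsphere(1)[OF n(1)] that by blast
  have b: "b i = - 1 / sqrt (real n)" if "i < n" for i
    unfolding b_def using diag_rotation_sphere_base[OF n(1) that] .
  have w: "\<forall>i\<ge>n. w i = 0" "dot n w b = 0" "dot n w w \<noteq> 0"
  proof -
    show "\<forall>i\<ge>n. w i = 0" by (simp add: w_def diag_rotation_def Let_def)
    have "1 < n" using n by simp
    then show "dot n w b = 0" "dot n w w \<noteq> 0"
      unfolding w_def b_def diag_rotation_dot[OF n(1) u0 u0] diag_rotation_dot[OF n(1) u0 S0[OF base]]
      by (simp_all add: dot_unit sphere_base_def)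
  qed
  \<comment> \<open>The exponents differ by \<open>p * (p - 1)\<close>, which is even.\<close>
  have parity: "reflect_power n w (p * (n - 1)) = reflect_power n w (p * q)"
    using pq by (auto simp: reflect_power_def n_def even_diff_nat)
  have "based_homotopic n b (\<lambda>x. x \<circ> \<sigma>) (reflect_power n w (p * q))"
    unfolding \<sigma>_def using initial_cycle_funpow_homotopic[OF n(1) b w, of p]
    unfolding parity .
  then obtain k where
    k: "continuous_map (prod_topology (top_of_set {0..1::real}) (nsphere (n - 1))) (nsphere (n - 1)) k"
    and k0: "\<And>x. k (0, x) = x \<circ> \<sigma>" and k1: "\<And>x. k (1, x) = reflect_power n w (p * q) x"
    and kb: "\<And>s. s \<in> {0..1} \<Longrightarrow> k (s, b) = b"
    by (auto simp: homotopic_with_def)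
  have kS: "k (s, x) \<in> ?S" if "s \<in> {0..1}" "x \<in> ?S" for s x
    using continuous_map_image_subset_topspace[OF k] that by auto
  have \<Phi>: "continuous_map (nsphere (n - 1)) X \<Phi>"
    unfolding \<Phi>_def using continuous_map_cube_projection[OF n(1)] continuous_map_cross_map[OF pq(2,1) g f]
    by (intro continuous_map_compose) (auto simp: n_def add.commute)
  have F: "sphere_map (n - 1) (whitehead p q f g) z = \<Phi> (diag_rotation n z \<circ> \<sigma>)" if z: "z \<in> ?S" for z
  proof -
    let ?t = "cube_projection n (diag_rotation n z)"
    have t: "?t \<in> cube_boundary (p + q)" using cube_projection_in[OF n(1) R[OF z]] by (simp add: n_def)
    \<comment> \<open>The permuted point is the value of \<open>k\<close> at time 0, hence on the
      sphere.\<close>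
    have "diag_rotation n z \<circ> \<sigma> \<in> ?S" using kS[of 0] R[OF z] k0 by auto
    then have "cube_projection n (diag_rotation n z \<circ> \<sigma>) \<in> cube_boundary (p + q)"
      using cube_projection_in[OF n(1)] by (simp add: n_def)
    then have t\<sigma>: "?t \<circ> \<sigma> \<in> cube_boundary (p + q)"
      unfolding \<sigma>_def cube_projection_cycle[OF n(1)] .
    have "sphere_map (n - 1) (whitehead p q f g) z
        = wedge_map (sphere_map p f) (sphere_map q g) (attaching_map p q z)"
      unfolding whitehead_def n_def[symmetric]
      by (subst sphere_map_comp_collapse) (use n z in auto)
    also have "\<dots> = cross_map p q f g ?t"
      unfolding attaching_map_def Let_def sphere_to_cube_boundary_eq n_def[symmetric]
      using wedge_map_cross_map[OF pq f g t] .
    also have "\<dots> = cross_map q p g f (?t \<circ> \<sigma>)"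
      using cross_map_swap[OF pq f g t] t\<sigma> by (simp add: \<sigma>_def n_def)
    also have "\<dots> = \<Phi> (diag_rotation n z \<circ> \<sigma>)"
      unfolding \<Phi>_def \<sigma>_def comp_apply[of "cross_map q p g f"] cube_projection_cycle[OF n(1)] ..
    finally show ?thesis .
  qed
  have G: "sphere_map (n - 1) (sign_loop (p * q) (whitehead q p g f)) z
      = \<Phi> (reflect_power n w (p * q) (diag_rotation n z))" if z: "z \<in> ?S" for z
  proof -
    let ?z = "reflect_power n ?u (p * q) z"
    have z': "?z \<in> ?S" using reflect_in_nsphere[OF n(1) z u0] z by (simp add: reflect_power_def)
    have t: "cube_projection n (diag_rotation n ?z) \<in> cube_boundary (q + p)"
      using cube_projection_in[OF n(1) R[OF z']] by (simp add: n_def add.commute)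
    have n': "q + p = n" by (simp add: n_def)
    have "sphere_map (n - 1) (sign_loop (p * q) (whitehead q p g f)) z
        = wedge_map (sphere_map q g) (sphere_map p f) (attaching_map q p ?z)"
      unfolding whitehead_def n'
      by (subst sphere_map_sign_loop[OF n(2) z]) simp
    also have "\<dots> = cross_map q p g f (cube_projection n (diag_rotation n ?z))"
      unfolding attaching_map_def Let_def sphere_to_cube_boundary_eq n'
      using wedge_map_cross_map[OF pq(2,1) g f t] .
    also have "diag_rotation n ?z = reflect_power n w (p * q) (diag_rotation n z)"
      using diag_rotation_reflect_power[OF n(1) S0[OF z] u0] by (simp only: w_def)
    finally show ?thesis by (simp add: \<Phi>_def)
  qed
  let ?H = "\<lambda>(z, s). \<Phi> (k (s, diag_rotation n z))"
  let ?F = "sphere_map (n - 1) (whitehead p q f g)"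
  let ?G = "sphere_map (n - 1) (sign_loop (p * q) (whitehead q p g f))"
  have H0: "?H (z, 0) = ?F z" and H1: "?H (z, 1) = ?G z" if "z \<in> ?S" for z
    using F[OF that] G[OF that] k0 k1 by simp_all
  have "continuous_map (prod_topology (nsphere (n - 1)) (top_of_set {0..1::real}))
      (prod_topology (top_of_set {0..1::real}) (nsphere (n - 1))) (\<lambda>x. (snd x, (diag_rotation n \<circ> fst) x))"
    using continuous_map_diag_rotation[OF n(1)]
    by (intro continuous_map_pairedI continuous_map_snd continuous_map_compose[OF continuous_map_fst])
  then have "continuous_map (prod_topology (nsphere (n - 1)) (top_of_set {0..1::real})) X
      (\<Phi> \<circ> (k \<circ> (\<lambda>x. (snd x, (diag_rotation n \<circ> fst) x))))"
    by (intro continuous_map_compose[OF _ \<Phi>] continuous_map_compose[OF _ k])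
  then have cont: "continuous_map (prod_topology (nsphere (n - 1)) (top_of_set {0..1::real})) X ?H"
    by (simp add: o_def case_prod_unfold)
  have "?H (sphere_base, s) = x0" if "s \<in> {0..1}" for s
  proof -
    have zero: "(\<lambda>_. 0) \<in> cube_boundary p"
      using pq by (auto simp: cube_boundary_def topspace_cube intro!: exI[of _ 0])
    \<comment> \<open>Since \<open>k\<close> fixes \<open>b\<close> at all times, evaluation at time
      0 is enough.\<close>
    have "?H (sphere_base, s) = ?H (sphere_base, 0)"
      using kb[OF that] kb[of 0] by (simp add: b_def)
    also have "\<dots> = ?F sphere_base" using H0[OF base] .
    also have "\<dots> = wedge_map (sphere_map p f) (sphere_map q g) (attaching_map p q sphere_base)"
      unfolding whitehead_def n_def[symmetric]
      by (subst sphere_map_comp_collapse) (use n base in auto)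
    also have "\<dots> = sphere_map p f (collapse p (\<lambda>_. 0))"
      using attaching_map_sphere_base[OF pq] collapse_on_boundary[OF pq(1) zero] by (simp add: wedge_map_def)
    also have "\<dots> = x0"
      using sphere_map_collapse[OF pq(1) f, of "\<lambda>_. 0"] zero f by (simp add: Omega_def cube_boundary_def)
    finally show ?thesis .
  qed
  moreover have "?H ` (?S \<times> {0..1}) = ?F ` ?S \<union> ?G ` ?S"
  proof (intro subset_antisym subsetI)
    fix y assume "y \<in> ?H ` (?S \<times> {0..1})"
    then obtain z s where "z \<in> ?S" "s \<in> {0..1}" "y = \<Phi> (k (s, diag_rotation n z))" by auto
    then obtain x where x: "x \<in> ?S" "y = \<Phi> x" using kS R by blast
    \<comment> \<open>The end \<open>?G\<close> alone attains every value of \<open>\<Phi>\<close>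
      on the sphere: reflecting \<open>x\<close> first cancels the reflection built into
      \<open>?G\<close>, and the rotation is onto.\<close>
    let ?x = "reflect_power n w (p * q) x"
    have "?x \<in> ?S" using reflect_in_nsphere[OF n(1) x(1) w(1)] x by (simp add: reflect_power_def)
    then obtain z where z: "z \<in> ?S" "?x = diag_rotation n z"
      using diag_rotation_nsphere(2)[OF n(1)] by blast
    have "reflect_power n w (p * q) ?x = x"
      by (simp add: reflect_power_def reflect_reflect)
    then have "y = ?G z" using G[OF z(1)] x z(2) by simp
    then show "y \<in> ?F ` ?S \<union> ?G ` ?S" using z(1) by blast
  next
    fix y assume "y \<in> ?F ` ?S \<union> ?G ` ?S"
    then obtain z where z: "z \<in> ?S" and "y = ?F z \<or> y = ?G z" by blast
    then have "y = ?H (z, 0) \<or> y = ?H (z, 1)" using H0[OF z] H1[OF z] by simp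
    moreover have "(z, 0) \<in> ?S \<times> {0..1::real}" "(z, 1) \<in> ?S \<times> {0..1::real}" using z by auto
    ultimately show "y \<in> ?H ` (?S \<times> {0..1})" by blast
  qed
  ultimately show ?thesis
    unfolding ir_homotopic_def n_def[symmetric] using cont H0 H1 by (intro exI[of _ ?H]) blast
qed

end
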